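(* (i) If $\mathrm{reg}(K[S])=2$, then $K[S]$ is a Buchsbaum ring. (ii) If $a_1=1$ and $a_{k-1}=d-1$, then $K[S]$ is a Buchsbaum ring if and only if $\mathrm{reg}(K[S])=2$. (iii) Assume that $a_1=1$, $a_{k-1}=d-1$ and $k<d$. Let $\varepsilon=\max\{i\mid 1,\dots,i,\ d-1,\dots,d-i\in\{a_1,\dots,a_{k-1}\}\}$, and let $\lambda_{\max}=\max_{1\le i\le k}(a_i-a_{i-1}-1)$ be the largest gap. If $\lambda_{\max}\le\varepsilon$, then $K[S]$ is a Buchsbaum ring.
   Context: Let $K$ be a field, $k\ge 3$, and let $0=:a_0<a_1<\cdots<a_k=:d$ be integers with $\gcd(a_1,\dots,a_k)=1$ and $k<d$. Let $S\subset\mathbb N^2$ be the additive monoid generated by $(a_i,d-a_i)$, $0\le i\le k$, and $K[S]$ its semigroup ring (isomorphic to $K[s^{a_i}t^{d-a_i}\mid 0\le i\le k]$), graded by $\deg(u_1,u_2)=(u_1+u_2)/d$, with maximal homogeneous ideal $\mathfrak m$. Put $a_i(K[S])=\sup\{n\mid H^i_{\mathfrak m}(K[S])_n\ne0\}$ (with $\sup\emptyset=-\infty$; not to be confused with the integers $a_i$); the Castelnuovo--Mumford regularity is $\mathrm{reg}(K[S])=\max\{a_1(K[S])+1,\ a_2(K[S])+2\}$. $K[S]$ is called Buchsbaum if $\mathfrak m H^1_{\mathfrak m}(K[S])=0$ (in particular, Cohen--Macaulay rings $K[S]$ are Buchsbaum). *)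

theory Defs
  imports
    "HOL-Library.Poly_Mapping"
    "HOL-Library.Product_Plus"
    "HOL-Library.Extended_Real"
begin

section \<open>The semigroup ring\<close>

inductive_set generated_monoid :: "'a::comm_monoid_add set \<Rightarrow> 'a set" for G where
  zero: "0 \<in> generated_monoid G"
| add: "u \<in> generated_monoid G \<Longrightarrow> g \<in> G \<Longrightarrow> u + g \<in> generated_monoid G"

text \<open>The exponents of the semigroup are written in \<open>\<int>\<^sup>2\<close> (they all lie in \<open>\<nat>\<^sup>2\<close> when
  \<open>a i \<le> a k\<close>), and \<open>K[S]\<close> is the subring of the group ring
  \<open>K[\<int>\<^sup>2] = K[s, s\<^sup>-\<^sup>1, t, t\<^sup>-\<^sup>1]\<close> of the elements supported in \<open>S\<close>. All localizations
  at monomials can then be formed inside \<open>K[\<int>\<^sup>2]\<close>. Throughout, \<open>d = a k\<close>.\<close>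

type_synonym 'k laurent = "(int \<times> int) \<Rightarrow>\<^sub>0 'k"

definition exponent :: "(nat \<Rightarrow> nat) \<Rightarrow> nat \<Rightarrow> nat \<Rightarrow> int \<times> int" where
  "exponent a k i = (int (a i), int (a k) - int (a i))"

definition semigroup :: "(nat \<Rightarrow> nat) \<Rightarrow> nat \<Rightarrow> (int \<times> int) set" where
  "semigroup a k = generated_monoid (exponent a k ` {0..k})"

definition semigroup_ring :: "(nat \<Rightarrow> nat) \<Rightarrow> nat \<Rightarrow> 'k::field laurent set" where
  "semigroup_ring a k = {f. Poly_Mapping.keys f \<subseteq> semigroup a k}"

definition generator :: "(nat \<Rightarrow> nat) \<Rightarrow> nat \<Rightarrow> nat \<Rightarrow> 'k::field laurent" where
  "generator a k i = Poly_Mapping.single (exponent a k i) 1"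

definition max_homogeneous_ideal :: "(nat \<Rightarrow> nat) \<Rightarrow> nat \<Rightarrow> 'k::field laurent set" where
  "max_homogeneous_ideal a k = {f \<in> semigroup_ring a k. Poly_Mapping.lookup f 0 = 0}"

text \<open>Homogeneity of degree \<open>n\<close> for the grading \<open>deg (u\<^sub>1, u\<^sub>2) = (u\<^sub>1 + u\<^sub>2) / d\<close>.\<close>

definition homogeneous :: "nat \<Rightarrow> int \<Rightarrow> 'k::field laurent \<Rightarrow> bool" where
  "homogeneous d n f \<longleftrightarrow> (\<forall>(u, v) \<in> Poly_Mapping.keys f. u + v = n * int d)"


section \<open>Local cohomology\<close>

text \<open>The localization \<open>R\<^sub>f = {r / f\<^sup>n | r \<in> R, n \<in> \<nat>}\<close> of a subring \<open>R\<close> at an element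
  \<open>f \<in> R\<close> that is a unit of the ambient ring (as every monomial is in \<open>K[\<int>\<^sup>2]\<close>).\<close>

definition localization :: "'a::comm_ring_1 set \<Rightarrow> 'a \<Rightarrow> 'a set" where
  "localization R f = {g. \<exists>n::nat. f ^ n * g \<in> R}"

text \<open>The local cohomology with support in the ideal generated by \<open>f\<^sub>0, \<dots>, f\<^sub>k\<close> is the
  cohomology of the Cech complex \<open>C\<^sup>p = \<Oplus> R\<^sub>f\<^sub>I\<close>, where \<open>I\<close> ranges over the \<open>p\<close>-element subsets
  of \<open>{0, \<dots>, k}\<close> and \<open>f\<^sub>I\<close> is the product of the \<open>f\<^sub>i\<close> with \<open>i \<in> I\<close>. Cochains are functions on
  index sets that vanish on the irrelevant ones.\<close>

definition cech_cochains ::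
    "'a::comm_ring_1 set \<Rightarrow> (nat \<Rightarrow> 'a) \<Rightarrow> nat \<Rightarrow> nat \<Rightarrow> (nat set \<Rightarrow> 'a) set" where
  "cech_cochains R f k p =
     {c. \<forall>I. if I \<subseteq> {0..k} \<and> card I = p then c I \<in> localization R (\<Prod>i\<in>I. f i) else c I = 0}"

definition cech_differential :: "nat \<Rightarrow> (nat set \<Rightarrow> 'a::comm_ring_1) \<Rightarrow> nat set \<Rightarrow> 'a" where
  "cech_differential k c J =
     (if J \<subseteq> {0..k} then \<Sum>j\<in>J. (- 1) ^ card {i \<in> J. i < j} * c (J - {j}) else 0)"

definition cech_cocycles ::
    "'a::comm_ring_1 set \<Rightarrow> (nat \<Rightarrow> 'a) \<Rightarrow> nat \<Rightarrow> nat \<Rightarrow> (nat set \<Rightarrow> 'a) set" where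
  "cech_cocycles R f k p = {c \<in> cech_cochains R f k p. cech_differential k c = (\<lambda>_. 0)}"

primrec cech_coboundaries ::
    "'a::comm_ring_1 set \<Rightarrow> (nat \<Rightarrow> 'a) \<Rightarrow> nat \<Rightarrow> nat \<Rightarrow> (nat set \<Rightarrow> 'a) set" where
  "cech_coboundaries R f k 0 = {\<lambda>_. 0}"
| "cech_coboundaries R f k (Suc p) = cech_differential k ` cech_cochains R f k p"

text \<open>The class of the cocycle \<open>z\<close> in the quotient of the cocycles by the coboundaries.\<close>

definition cohomology_class ::
    "'a::comm_ring_1 set \<Rightarrow> (nat \<Rightarrow> 'a) \<Rightarrow> nat \<Rightarrow> nat \<Rightarrow> (nat set \<Rightarrow> 'a) \<Rightarrow> (nat set \<Rightarrow> 'a) set"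
  where
  "cohomology_class R f k p z =
     {c \<in> cech_cocycles R f k p. (\<lambda>I. c I - z I) \<in> cech_coboundaries R f k p}"

text \<open>From here on the complex is the one of \<open>K[S]\<close> and its algebra generators, which generate
  the maximal homogeneous ideal.\<close>

abbreviation local_cocycles ::
    "(nat \<Rightarrow> nat) \<Rightarrow> nat \<Rightarrow> nat \<Rightarrow> (nat set \<Rightarrow> 'k::field laurent) set" where
  "local_cocycles a k p \<equiv> cech_cocycles (semigroup_ring a k) (generator a k) k p"

abbreviation local_class ::
    "(nat \<Rightarrow> nat) \<Rightarrow> nat \<Rightarrow> nat \<Rightarrow> (nat set \<Rightarrow> 'k::field laurent)
      \<Rightarrow> (nat set \<Rightarrow> 'k laurent) set" where
  "local_class a k p \<equiv> cohomology_class (semigroup_ring a k) (generator a k) k p"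

definition local_cohomology_graded ::
    "(nat \<Rightarrow> nat) \<Rightarrow> nat \<Rightarrow> nat \<Rightarrow> int \<Rightarrow> (nat set \<Rightarrow> 'k::field laurent) set set" where
  "local_cohomology_graded a k p n =
     local_class a k p ` {z \<in> local_cocycles a k p. \<forall>I. homogeneous (a k) n (z I)}"


section \<open>Regularity and the Buchsbaum property\<close>

text \<open>The supremum is taken in the extended reals, so that it is \<open>-\<infinity>\<close> on the empty set. The
  first argument only serves to name the field.\<close>

definition a_invariant :: "'k::field itself \<Rightarrow> (nat \<Rightarrow> nat) \<Rightarrow> nat \<Rightarrow> nat \<Rightarrow> ereal" where
  "a_invariant _ a k p =
     (SUP n \<in> {n::int. (local_cohomology_graded a k p n :: (nat set \<Rightarrow> 'k laurent) set set)
                         \<noteq> {local_class a k p (\<lambda>_. 0)}}. ereal (real_of_int n))"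

definition regularity :: "'k::field itself \<Rightarrow> (nat \<Rightarrow> nat) \<Rightarrow> nat \<Rightarrow> ereal" where
  "regularity K a k = max (a_invariant K a k 1 + 1) (a_invariant K a k 2 + 2)"

definition buchsbaum :: "'k::field itself \<Rightarrow> (nat \<Rightarrow> nat) \<Rightarrow> nat \<Rightarrow> bool" where
  "buchsbaum _ a k \<longleftrightarrow>
     (\<forall>f \<in> (max_homogeneous_ideal a k :: 'k laurent set). \<forall>z \<in> local_cocycles a k 1.
        local_class a k 1 (\<lambda>I. f * z I) = local_class a k 1 (\<lambda>_. 0))"


section \<open>Combinatorial invariants of the sequence\<close>

definition epsilon :: "(nat \<Rightarrow> nat) \<Rightarrow> nat \<Rightarrow> nat" where
  "epsilon a k = Max {i. \<forall>j \<in> {1..i}. j \<in> a ` {1..k - 1} \<and> a k - j \<in> a ` {1..k - 1}}"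

definition lambda_max :: "(nat \<Rightarrow> nat) \<Rightarrow> nat \<Rightarrow> nat" where
  "lambda_max a k = Max ((\<lambda>i. a i - a (i - 1) - 1) ` {1..k})"

end

theory Submission
  imports Defs
begin

text \<open>A 1-cocycle of the Cech complex is a single element lying in every localization at a generator,
  so \<open>H\<^sup>1 = K[S'] / K[S]\<close> for the semigroup \<open>S'\<close> of all \<open>x\<close> such that each \<open>x + n e\<^sub>i\<close> is in \<open>S\<close> for
  some \<open>n\<close>, and \<open>S'\<close> lies in degrees \<open>\<ge> 0\<close> with only \<open>0\<close> in degree \<open>0\<close>. Everything is compared
  with the condition that \<open>S'\<close> and \<open>S\<close> agree in degrees \<open>\<ge> 2\<close>. It is equivalent to
  \<open>a\<^sub>1(K[S]) \<le> 1\<close>, and it makes the maximal ideal kill \<open>H\<^sup>1\<close>. If \<open>1\<close> and \<open>d - 1\<close> are among the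
  \<open>a\<^sub>i\<close>, then \<open>S'\<close> consists of all lattice points of \<open>\<nat>\<^sup>2\<close> of integral degree; each of them in
  degree \<open>\<ge> 2\<close> is \<open>e\<^sub>0\<close> or \<open>e\<^sub>k\<close> plus an element of \<open>S'\<close>, so the Buchsbaum property implies the
  condition, which in turn makes \<open>H\<^sup>2\<close> vanish in positive degrees.\<close>

section \<open>Monomials and localization\<close>

text \<open>A monomial is a unit of the group ring: multiplying back by the monomial of exponent
  \<open>- e\<close> turns the general inclusion for products into an equality.\<close>

lemma keys_single_times:
  fixes g :: "'a::ab_group_add \<Rightarrow>\<^sub>0 'k::comm_ring_1"
  shows "Poly_Mapping.keys (Poly_Mapping.single e 1 * g) = (+) e ` Poly_Mapping.keys g"
proof -
  have sub: "Poly_Mapping.keys (Poly_Mapping.single e' 1 * h) \<subseteq> (+) e' ` Poly_Mapping.keys h"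
    for e' and h :: "'a \<Rightarrow>\<^sub>0 'k"
  proof -
    have "Poly_Mapping.keys (Poly_Mapping.single e' (1::'k)) = {e'}"
      by simp
    then show ?thesis
      using keys_mult[of "Poly_Mapping.single e' 1" h] by auto
  qed
  have "Poly_Mapping.single (- e) 1 * (Poly_Mapping.single e 1 * g) = g"
    by (simp add: mult.assoc[symmetric] mult_single)
  then have "Poly_Mapping.keys g \<subseteq> (+) (- e) ` Poly_Mapping.keys (Poly_Mapping.single e 1 * g)"
    using sub[of "- e" "Poly_Mapping.single e 1 * g"] by simp
  then have "(+) e ` Poly_Mapping.keys g \<subseteq> Poly_Mapping.keys (Poly_Mapping.single e 1 * g)"
    by force
  then show ?thesis
    using sub[of e g] by blast
qed

lemma keys_diff_subset:
  fixes f g :: "'a \<Rightarrow>\<^sub>0 'k::ab_group_add"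
  shows "Poly_Mapping.keys (f - g) \<subseteq> Poly_Mapping.keys f \<union> Poly_Mapping.keys g"
  by (auto simp: in_keys_iff lookup_minus)

lemma prod_single_one:
  "(\<Prod>i\<in>I. Poly_Mapping.single (e i) (1::'k::comm_ring_1)) = Poly_Mapping.single (\<Sum>i\<in>I. e i) 1"
  by (induction I rule: infinite_finite_induct) (auto simp: mult_single)

text \<open>The exponent of the \<open>n\<close>-th power of the monomial with exponent
  \<open>x\<close>.\<close>

definition multiple :: "nat \<Rightarrow> int \<times> int \<Rightarrow> int \<times> int" where
  "multiple n x = (int n * fst x, int n * snd x)"

lemma multiple_0 [simp]: "multiple 0 x = 0"
  by (simp add: multiple_def zero_prod_def)

lemma multiple_Suc: "multiple (Suc n) x = x + multiple n x"
  by (cases x) (simp add: multiple_def algebra_simps)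

lemma multiple_add: "multiple (m + n) x = multiple m x + multiple n x"
  by (simp add: multiple_def algebra_simps)

lemma single_one_power:
  "Poly_Mapping.single x (1::'k::comm_ring_1) ^ n = Poly_Mapping.single (multiple n x) 1"
  by (induction n) (auto simp: multiple_Suc mult_single)

text \<open>Both fractions are brought to the common denominator \<open>f ^ (m + n)\<close>.\<close>

lemma localization_diff:
  assumes diff: "\<And>x y. x \<in> R \<Longrightarrow> y \<in> R \<Longrightarrow> x - y \<in> R"
    and mult: "\<And>x y. x \<in> R \<Longrightarrow> y \<in> R \<Longrightarrow> x * y \<in> R"
    and "1 \<in> R" and "f \<in> R"
    and g: "g \<in> localization R f" and h: "h \<in> localization R f"
  shows "g - h \<in> localization R f"
proof -
  have pow: "f ^ n \<in> R" for n
    by (induction n) (use assms in auto)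
  obtain m n where "f ^ m * g \<in> R" "f ^ n * h \<in> R"
    using g h by (auto simp: localization_def)
  then have "f ^ n * (f ^ m * g) - f ^ m * (f ^ n * h) \<in> R"
    by (meson diff mult pow)
  also have "f ^ n * (f ^ m * g) - f ^ m * (f ^ n * h) = f ^ (m + n) * (g - h)"
    by (simp add: power_add algebra_simps)
  finally show ?thesis
    by (auto simp: localization_def)
qed


section \<open>The Cech complex in low degrees\<close>

lemma cech_differential_eq_zero:
  assumes "\<And>I. card I \<noteq> p \<Longrightarrow> c I = 0" and "card J \<noteq> Suc p"
  shows "cech_differential k c J = 0"
proof (cases "J \<subseteq> {0..k}")
  case True
  then have "finite J"
    using finite_subset by blast
  have "c (J - {j}) = 0" if "j \<in> J" for j
    using assms that card_Suc_Diff1[OF \<open>finite J\<close> that] by metis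
  then show ?thesis
    by (simp add: cech_differential_def)
qed (simp add: cech_differential_def)

lemma cech_differential_singleton:
  assumes "i \<le> k"
  shows "cech_differential k c {i} = c {}"
proof -
  have sets: "{l \<in> {i}. l < i} = {}"
    by auto
  have "(- 1) ^ card {l \<in> {i}. l < i} * c ({i} - {i}) = c {}"
    unfolding sets by simp
  then show ?thesis
    using assms unfolding cech_differential_def by simp
qed

lemma cech_differential_pair:
  assumes "i < j" "j \<le> k"
  shows "cech_differential k c {i, j} = c {j} - c {i}"
proof -
  let ?g = "\<lambda>m. (- 1) ^ card {l \<in> {i, j}. l < m} * c ({i, j} - {m})"
  have sets: "{l \<in> {i, j}. l < i} = {}" "{l \<in> {i, j}. l < j} = {i}"
      "{i, j} - {i} = {j}" "{i, j} - {j} = {i}"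
    using assms by auto
  have "sum g {i, j} = g i + g j" for g :: "nat \<Rightarrow> 'a"
    using assms(1) by simp
  moreover have "cech_differential k c {i, j} = sum ?g {i, j}"
    using assms by (simp only: cech_differential_def) simp
  moreover have "?g i = c {j}"
    unfolding sets by simp
  moreover have "?g j = - c {i}"
    unfolding sets by simp
  ultimately show ?thesis
    by (simp only:) simp
qed

lemma cech_differential_triple:
  assumes "h < i" "i < j" "j \<le> k"
  shows "cech_differential k c {h, i, j} = c {i, j} - c {h, j} + c {h, i}"
proof -
  let ?g = "\<lambda>m. (- 1) ^ card {l \<in> {h, i, j}. l < m} * c ({h, i, j} - {m})"
  have sets: "{l \<in> {h, i, j}. l < h} = {}" "{l \<in> {h, i, j}. l < i} = {h}"
      "{l \<in> {h, i, j}. l < j} = {h, i}"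
      "{h, i, j} - {h} = {i, j}" "{h, i, j} - {i} = {h, j}" "{h, i, j} - {j} = {h, i}"
    using assms by auto
  have "sum g {h, i, j} = g h + g i + g j" for g :: "nat \<Rightarrow> 'a"
    using assms(1,2) by (simp add: add.assoc)
  moreover have "cech_differential k c {h, i, j} = sum ?g {h, i, j}"
    using assms by (simp only: cech_differential_def) simp
  moreover have "?g h = c {i, j}"
    unfolding sets by simp
  moreover have "?g i = - c {h, j}"
    unfolding sets by simp
  moreover have "?g j = c {h, i}"
    unfolding sets using assms(1) by (simp add: power2_eq_square numeral_2_eq_2)
  ultimately show ?thesis
    by (simp only:) simp
qed

lemma cech_differential_diff:
  "cech_differential k (\<lambda>I. b I - c I) J = cech_differential k b J - cech_differential k c J"
  by (simp add: cech_differential_def algebra_simps sum_subtractf)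

lemma cech_differential_zero: "cech_differential k (\<lambda>I. 0) = (\<lambda>_. 0)"
  by (simp add: cech_differential_def fun_eq_iff)

text \<open>All 1-cocycles and all 1-coboundaries turn out to have this shape, so the first
  cohomology can be computed with single ring elements.\<close>

definition constant_cochain :: "nat \<Rightarrow> 'a::comm_ring_1 \<Rightarrow> nat set \<Rightarrow> 'a" where
  "constant_cochain k g I = (if \<exists>i\<le>k. I = {i} then g else 0)"

lemma constant_cochain_singleton [simp]: "i \<le> k \<Longrightarrow> constant_cochain k g {i} = g"
  by (simp add: constant_cochain_def)

lemma constant_cochain_inject [simp]: "constant_cochain k g = constant_cochain k h \<longleftrightarrow> g = h"
  by (metis constant_cochain_singleton le0)

lemma subset_card_1_iff: "I \<subseteq> {0..k} \<and> card I = 1 \<longleftrightarrow> (\<exists>i\<le>k. I = {i::nat})"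
  by (auto simp: card_1_singleton_iff)

lemma card_2_ordered:
  fixes J :: "'a::linorder set"
  assumes "card J = 2"
  obtains i j where "i < j" "J = {i, j}"
proof -
  obtain x y where xy: "J = {x, y}" "x \<noteq> y"
    using assms by (auto simp: card_2_iff)
  show thesis
  proof (cases "x < y")
    case True
    then show ?thesis
      using that[of x y] xy by simp
  next
    case False
    then show ?thesis
      using that[of y x] xy by (simp add: insert_commute)
  qed
qed

text \<open>The only index set in degree 0 is \<open>{}\<close>, whose product of generators is 1,
  so 0-cochains are elements of \<open>R\<close>; the differential copies such an element to every
  vertex.\<close>

lemma cech_coboundaries_1:
  "cech_coboundaries R f k 1 = constant_cochain k ` R"
proof -
  have C0: "cech_cochains R f k 0 = (\<lambda>r I. if I = {} then r else 0) ` R"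
  proof -
    have "I \<subseteq> {0..k} \<and> card I = 0 \<longleftrightarrow> I = {}" for I
      using finite_subset[of I "{0..k}"] by auto
    then have "cech_cochains R f k 0 = {c. \<forall>I. if I = {} then c I \<in> R else c I = 0}"
      unfolding cech_cochains_def by (intro Collect_cong all_cong1) (auto simp: localization_def)
    also have "\<dots> = (\<lambda>r I. if I = {} then r else 0) ` R"
    proof (intro set_eqI iffI)
      fix c :: "nat set \<Rightarrow> 'a"
      assume "c \<in> {c. \<forall>I. if I = {} then c I \<in> R else c I = 0}"
      then have "c {} \<in> R" "c = (\<lambda>I. if I = {} then c {} else 0)"
        by (auto simp: fun_eq_iff split: if_splits)
      then show "c \<in> (\<lambda>r I. if I = {} then r else 0) ` R"
        by (rule rev_image_eqI)
    qed (auto split: if_splits)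
    finally show ?thesis .
  qed
  have "cech_differential k (\<lambda>I. if I = {} then r else 0) = constant_cochain k r" for r :: 'a
  proof
    fix J :: "nat set"
    show "cech_differential k (\<lambda>I. if I = {} then r else 0) J = constant_cochain k r J"
    proof (cases "\<exists>i\<le>k. J = {i}")
      case True
      then show ?thesis
        by (auto simp: cech_differential_singleton)
    next
      case False
      show ?thesis
      proof (cases "J \<subseteq> {0..k}")
        case True
        then have "card J \<noteq> Suc 0"
          using False subset_card_1_iff[of J k] by simp
        then have "cech_differential k (\<lambda>I. if I = {} then r else 0) J = 0"
          by (intro cech_differential_eq_zero[where p = 0]) auto
        then show ?thesis
          using False by (auto simp: constant_cochain_def)
      next
        case F: False
        then show ?thesis
          using False by (auto simp: constant_cochain_def cech_differential_def)
      qed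
    qed
  qed
  then show ?thesis
    by (simp add: C0 image_image)
qed

text \<open>The cocycle equation on \<open>{0, i}\<close> says that the components at
  \<open>0\<close> and \<open>i\<close> agree. All localizations are subsets of one ambient ring, so
  the common value lies in their intersection.\<close>

lemma cech_cocycles_1:
  "cech_cocycles R f k 1 = constant_cochain k ` (\<Inter>i\<in>{0..k}. localization R (f i))"
proof (intro set_eqI iffI)
  fix z
  assume z: "z \<in> cech_cocycles R f k 1"
  then have out: "z I = 0" if "\<not> (\<exists>i\<le>k. I = {i})" for I
    using that subset_card_1_iff[of I k] by (auto simp: cech_cocycles_def cech_cochains_def)
  have eq: "z {i} = z {0}" if "i \<le> k" for i
  proof (cases "i = 0")
    case False
    have "cech_differential k z {0, i} = 0"
      using z by (simp add: cech_cocycles_def)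
    then show ?thesis
      using False that by (simp add: cech_differential_pair)
  qed simp
  have "z {i} \<in> localization R (f i)" if "i \<le> k" for i
    using z that by (auto simp: cech_cocycles_def cech_cochains_def dest: spec[of _ "{i}"])
  then have "z {0} \<in> (\<Inter>i\<in>{0..k}. localization R (f i))"
    using eq by (metis INT_I atLeastAtMost_iff)
  moreover have "z I = constant_cochain k (z {0}) I" for I
    unfolding constant_cochain_def using out[of I] eq by metis
  ultimately show "z \<in> constant_cochain k ` (\<Inter>i\<in>{0..k}. localization R (f i))"
    by (metis ext image_eqI)
next
  fix z
  assume "z \<in> constant_cochain k ` (\<Inter>i\<in>{0..k}. localization R (f i))"
  then obtain g where z: "z = constant_cochain k g" and g: "\<And>i. i \<le> k \<Longrightarrow> g \<in> localization R (f i)"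
    by auto
  have "z \<in> cech_cochains R f k 1"
    unfolding cech_cochains_def mem_Collect_eq
  proof
    fix I
    show "if I \<subseteq> {0..k} \<and> card I = 1 then z I \<in> localization R (prod f I) else z I = 0"
    proof (cases "\<exists>i\<le>k. I = {i}")
      case True
      then obtain i where "i \<le> k" "I = {i}"
        by blast
      then show ?thesis
        using g by (simp add: z)
    next
      case False
      then show ?thesis
        unfolding subset_card_1_iff if_not_P[OF False] by (auto simp: z constant_cochain_def)
    qed
  qed
  moreover have "cech_differential k z J = 0" for J
  proof (cases "J \<subseteq> {0..k} \<and> card J = 2")
    case True
    then have "card J = 2"
      by simp
    then obtain i j where "i < j" "J = {i, j}"
      by (rule card_2_ordered)
    moreover from this True have "j \<le> k"
      by simp
    ultimately show ?thesis
      by (simp add: cech_differential_pair z)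
  next
    case False
    show ?thesis
    proof (cases "J \<subseteq> {0..k}")
      case True
      then show ?thesis
        using False
        by (intro cech_differential_eq_zero[where p = 1]) (auto simp: z constant_cochain_def)
    qed (simp add: cech_differential_def)
  qed
  ultimately show "z \<in> cech_cocycles R f k 1"
    by (simp add: cech_cocycles_def fun_eq_iff)
qed

text \<open>The class of \<open>z\<close> contains \<open>z\<close>, and the class of 0 contains
  only coboundaries. Conversely, closure of the coboundaries under subtraction makes the class of a
  coboundary coincide with that of 0.\<close>

lemma cohomology_class_eq_zero_iff:
  assumes z: "z \<in> cech_cocycles R f k p"
    and diff: "\<And>b c. b \<in> cech_coboundaries R f k p \<Longrightarrow> c \<in> cech_coboundaries R f k p
      \<Longrightarrow> (\<lambda>I. b I - c I) \<in> cech_coboundaries R f k p"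
    and zero: "(\<lambda>_. 0) \<in> cech_coboundaries R f k p"
  shows "cohomology_class R f k p z = cohomology_class R f k p (\<lambda>_. 0)
    \<longleftrightarrow> z \<in> cech_coboundaries R f k p"
proof
  assume "cohomology_class R f k p z = cohomology_class R f k p (\<lambda>_. 0)"
  moreover have "z \<in> cohomology_class R f k p z"
    using z zero by (simp add: cohomology_class_def)
  ultimately show "z \<in> cech_coboundaries R f k p"
    by (simp add: cohomology_class_def)
next
  assume zB: "z \<in> cech_coboundaries R f k p"
  have neg: "(\<lambda>I. - z I) \<in> cech_coboundaries R f k p"
    using diff[OF zero zB] by simp
  have "c \<in> cech_coboundaries R f k p" if "(\<lambda>I. c I - z I) \<in> cech_coboundaries R f k p" for c
    using diff[OF that neg] by simp
  then show "cohomology_class R f k p z = cohomology_class R f k p (\<lambda>_. 0)"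
    using diff[OF _ zB] by (auto simp: cohomology_class_def)
qed

text \<open>The differential is additive, and each localization is closed under subtraction because
  the partial products of the \<open>f i\<close> lie in \<open>R\<close>.\<close>

lemma cech_coboundaries_diff:
  assumes R: "\<And>x y. x \<in> R \<Longrightarrow> y \<in> R \<Longrightarrow> x - y \<in> R" "\<And>x y. x \<in> R \<Longrightarrow> y \<in> R \<Longrightarrow> x * y \<in> R" "1 \<in> R"
    and f: "\<And>i. i \<le> k \<Longrightarrow> f i \<in> R"
    and "b \<in> cech_coboundaries R f k p" "c \<in> cech_coboundaries R f k p"
  shows "(\<lambda>I. b I - c I) \<in> cech_coboundaries R f k p"
proof (cases p)
  case (Suc q)
  have prod: "prod f I \<in> R" if "I \<subseteq> {0..k}" for I
    using that by (induction I rule: infinite_finite_induct) (use R f in auto)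
  from assms Suc obtain b' c' where b': "b' \<in> cech_cochains R f k q" "b = cech_differential k b'"
    and c': "c' \<in> cech_cochains R f k q" "c = cech_differential k c'"
    by auto
  have "(\<lambda>I. b' I - c' I) \<in> cech_cochains R f k q"
    unfolding cech_cochains_def mem_Collect_eq
  proof
    fix I
    show "if I \<subseteq> {0..k} \<and> card I = q then b' I - c' I \<in> localization R (prod f I) else b' I - c' I = 0"
      using b'(1) c'(1) localization_diff[OF R prod]
      by (auto simp: cech_cochains_def split: if_splits dest!: spec[of _ I])
  qed
  then show ?thesis
    by (auto simp: Suc b' c' cech_differential_diff[symmetric] fun_eq_iff
        intro!: image_eqI[where x = "\<lambda>I. b' I - c' I"])
qed (use assms in auto)

lemma zero_in_cech_coboundaries:
  assumes "0 \<in> R"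
  shows "(\<lambda>_. 0) \<in> cech_coboundaries R f k p"
proof (cases p)
  case (Suc q)
  have "(\<lambda>_. 0) \<in> cech_cochains R f k q"
    using assms by (auto simp: cech_cochains_def localization_def)
  then show ?thesis
    unfolding Suc cech_coboundaries.simps
    by (rule rev_image_eqI) (simp add: cech_differential_zero)
qed simp


section \<open>The first cohomology of a projective monomial curve\<close>

locale projective_monomial_curve =
  fixes a :: "nat \<Rightarrow> nat" and k :: nat
  assumes a_0: "a 0 = 0" and a_mono: "strict_mono_on {0..k} a" and k_pos: "0 < k"
begin

section \<open>Degrees and generators of the semigroup\<close>

lemma a_le: "i \<le> k \<Longrightarrow> a i \<le> a k"
  using strict_mono_on_leD[OF a_mono, of i k] by simp

lemma a_less: "i < j \<Longrightarrow> j \<le> k \<Longrightarrow> a i < a j"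
  using strict_mono_onD[OF a_mono, of i j] by simp

lemma degree_pos: "0 < a k"
  using a_less[of 0 k] k_pos a_0 by simp

lemma semigroup_add:
  assumes "x \<in> semigroup a k" "y \<in> semigroup a k"
  shows "x + y \<in> semigroup a k"
  using assms(2) unfolding semigroup_def
  by (induction rule: generated_monoid.induct)
    (use assms(1) in \<open>auto simp: semigroup_def add.assoc[symmetric] intro: generated_monoid.add\<close>)

lemma zero_in_semigroup [simp]: "0 \<in> semigroup a k"
  by (simp add: semigroup_def generated_monoid.zero)

lemma exponent_in_semigroup: "i \<le> k \<Longrightarrow> exponent a k i \<in> semigroup a k"
  using generated_monoid.add[OF generated_monoid.zero, of "exponent a k i" "exponent a k ` {0..k}"]
  by (auto simp: semigroup_def)

lemma multiple_in_semigroup: "x \<in> semigroup a k \<Longrightarrow> multiple n x \<in> semigroup a k"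
  by (induction n) (auto simp: multiple_Suc semigroup_add)

lemma sum_exponent_in_semigroup: "I \<subseteq> {0..k} \<Longrightarrow> (\<Sum>i\<in>I. exponent a k i) \<in> semigroup a k"
  by (induction I rule: infinite_finite_induct) (auto intro: semigroup_add exponent_in_semigroup)

lemma semigroup_bounds:
  assumes "x \<in> semigroup a k"
  shows "0 \<le> fst x \<and> 0 \<le> snd x \<and> int (a k) dvd fst x + snd x"
  using assms unfolding semigroup_def
proof (induction rule: generated_monoid.induct)
  case (add u g)
  then obtain i where i: "i \<le> k" "g = exponent a k i"
    by auto
  have "int (a k) dvd (fst u + snd u) + int (a k)"
    using add by simp
  then show ?case
    using add a_le[OF i(1)] by (simp add: i exponent_def algebra_simps)
qed simp

lemma semigroup_degree_pos:
  assumes "x \<in> semigroup a k" "x \<noteq> 0"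
  shows "int (a k) \<le> fst x + snd x"
proof -
  have "fst x + snd x > 0"
    using semigroup_bounds[OF assms(1)] assms(2) by (auto simp: prod_eq_iff)
  then show ?thesis
    using semigroup_bounds[OF assms(1)] by (simp add: zdvd_imp_le)
qed

lemma semigroup_degree_1:
  assumes "x \<in> semigroup a k" "fst x + snd x = int (a k)"
  shows "\<exists>i\<le>k. fst x = int (a i)"
  using assms(1) unfolding semigroup_def
proof (cases rule: generated_monoid.cases)
  case zero
  then show ?thesis
    using assms(2) degree_pos by simp
next
  case (add u g)
  then obtain i where i: "i \<le> k" "g = exponent a k i"
    by auto
  \<comment> \<open>A nonzero \<open>u\<close> would have degree at least 1, and \<open>g\<close>
    already accounts for the whole degree.\<close>
  have "u = 0"
    using semigroup_degree_pos[of u] assms(2) degree_pos add(1,2) i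
    by (fastforce simp: semigroup_def exponent_def)
  then show ?thesis
    using add(1) i by (auto simp: exponent_def)
qed

section \<open>The semigroup ring and its localizations at monomials\<close>

lemma semigroup_ring_diff:
  "f \<in> semigroup_ring a k \<Longrightarrow> g \<in> semigroup_ring a k \<Longrightarrow> f - g \<in> semigroup_ring a k"
  using keys_diff_subset[of f g] by (auto simp: semigroup_ring_def)

lemma semigroup_ring_mult:
  assumes "f \<in> semigroup_ring a k" "g \<in> semigroup_ring a k"
  shows "f * g \<in> semigroup_ring a k"
  unfolding semigroup_ring_def
proof (intro CollectI subsetI)
  fix w
  assume "w \<in> Poly_Mapping.keys (f * g)"
  then obtain x y where "x \<in> Poly_Mapping.keys f" "y \<in> Poly_Mapping.keys g" "w = x + y"
    using keys_mult[of f g] by blast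
  then show "w \<in> semigroup a k"
    using assms semigroup_add unfolding semigroup_ring_def by blast
qed

lemma one_in_semigroup_ring: "1 \<in> semigroup_ring a k"
  by (simp add: semigroup_ring_def)

lemma generator_in_semigroup_ring: "i \<le> k \<Longrightarrow> generator a k i \<in> semigroup_ring a k"
  by (simp add: semigroup_ring_def generator_def exponent_in_semigroup)

text \<open>Membership is tested monomial by monomial: the support is finite, and raising the power
  of the denominator beyond what one exponent needs stays in the semigroup, so one power serves all
  exponents.\<close>

lemma localization_monomial_iff:
  fixes g :: "'k::field laurent"
  assumes e: "e \<in> semigroup a k"
  shows "g \<in> localization (semigroup_ring a k) (Poly_Mapping.single e 1)
    \<longleftrightarrow> (\<forall>x\<in>Poly_Mapping.keys g. \<exists>n. multiple n e + x \<in> semigroup a k)"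
proof -
  have "g \<in> localization (semigroup_ring a k) (Poly_Mapping.single e 1)
    \<longleftrightarrow> (\<exists>n. \<forall>x\<in>Poly_Mapping.keys g. multiple n e + x \<in> semigroup a k)"
    by (auto simp: localization_def semigroup_ring_def single_one_power keys_single_times image_subset_iff)
  also have "\<dots> \<longleftrightarrow> (\<forall>x\<in>Poly_Mapping.keys g. \<exists>n. multiple n e + x \<in> semigroup a k)"
  proof
    assume "\<forall>x\<in>Poly_Mapping.keys g. \<exists>n. multiple n e + x \<in> semigroup a k"
    then obtain N where N: "\<And>x. x \<in> Poly_Mapping.keys g \<Longrightarrow> multiple (N x) e + x \<in> semigroup a k"
      by metis
    \<comment> \<open>Any common upper bound of the \<open>N x\<close> would do; the sum over the
      support is one.\<close>
    define M where "M = sum N (Poly_Mapping.keys g)"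
    have "multiple M e + x \<in> semigroup a k" if x: "x \<in> Poly_Mapping.keys g" for x
    proof -
      have "N x \<le> M"
        unfolding M_def using x by (intro member_le_sum) auto
      then have "multiple M e + x = multiple (M - N x) e + (multiple (N x) e + x)"
        using multiple_add[of "M - N x" "N x" e] by (simp add: add.assoc)
      then show ?thesis
        using semigroup_add[OF multiple_in_semigroup[OF e] N[OF x]] by metis
    qed
    then show "\<exists>n. \<forall>x\<in>Poly_Mapping.keys g. multiple n e + x \<in> semigroup a k"
      by blast
  qed blast
  finally show ?thesis .
qed

text \<open>Inverting a monomial of the semigroup shifts exponents by multiples of an element of
  integral degree, so degrees stay integral.\<close>

lemma local_cochain_keys:
  fixes c :: "nat set \<Rightarrow> 'k::field laurent"
  assumes c: "c \<in> cech_cochains (semigroup_ring a k) (generator a k) k p"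
    and x: "x \<in> Poly_Mapping.keys (c I)"
  shows "int (a k) dvd fst x + snd x"
proof -
  have I: "I \<subseteq> {0..k}" "c I \<in> localization (semigroup_ring a k) (\<Prod>i\<in>I. generator a k i)"
    using c x by (auto simp: cech_cochains_def split: if_splits dest!: spec[of _ I])
  define e where "e = (\<Sum>i\<in>I. exponent a k i)"
  have e: "e \<in> semigroup a k"
    unfolding e_def using I(1) by (rule sum_exponent_in_semigroup)
  have "c I \<in> localization (semigroup_ring a k) (Poly_Mapping.single e 1)"
    using I(2) by (simp add: generator_def prod_single_one e_def)
  then obtain n where n: "multiple n e + x \<in> semigroup a k"
    using x localization_monomial_iff[OF e] by blast
  have "int (a k) dvd int n * (fst e + snd e)"
    using semigroup_bounds[OF e] by simp
  moreover have "int (a k) dvd int n * (fst e + snd e) + (fst x + snd x)"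
    using semigroup_bounds[OF n] by (simp add: multiple_def algebra_simps)
  ultimately show ?thesis
    using dvd_add_right_iff by blast
qed

text \<open>The zero cochain is homogeneous of every degree, so each graded piece contains the zero
  class and differs from the trivial one exactly when some homogeneous cocycle is not a
  coboundary.\<close>

lemma local_cohomology_nonzero_iff:
  "(local_cohomology_graded a k p n :: (nat set \<Rightarrow> 'k::field laurent) set set)
      \<noteq> {local_class a k p (\<lambda>_. 0)}
    \<longleftrightarrow> (\<exists>z \<in> local_cocycles a k p. (\<forall>I. homogeneous (a k) n (z I :: 'k laurent))
          \<and> z \<notin> cech_coboundaries (semigroup_ring a k) (generator a k) k p)"
proof -
  let ?R = "semigroup_ring a k :: 'k laurent set"
  have zero_ring: "(0 :: 'k laurent) \<in> ?R"
    by (simp add: semigroup_ring_def)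
  have zero: "(\<lambda>_. 0 :: 'k laurent) \<in> local_cocycles a k p"
    using zero_ring by (auto simp: cech_cocycles_def cech_cochains_def cech_differential_zero localization_def)
  have "local_class a k p z = local_class a k p (\<lambda>_. 0)
      \<longleftrightarrow> z \<in> cech_coboundaries ?R (generator a k) k p" if "z \<in> local_cocycles a k p" for z
    using that
    by (intro cohomology_class_eq_zero_iff cech_coboundaries_diff zero_in_cech_coboundaries zero_ring
        semigroup_ring_diff semigroup_ring_mult one_in_semigroup_ring generator_in_semigroup_ring)
  moreover have "local_class a k p (\<lambda>_. 0) \<in> (local_cohomology_graded a k p n :: (nat set \<Rightarrow> 'k laurent) set set)"
    unfolding local_cohomology_graded_def using zero
    by (intro imageI) (simp add: homogeneous_def)
  moreover have "F ` A \<noteq> {y} \<longleftrightarrow> (\<exists>z\<in>A. F z \<noteq> y)" if "y \<in> F ` A"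
    for F :: "(nat set \<Rightarrow> 'k laurent) \<Rightarrow> (nat set \<Rightarrow> 'k laurent) set" and A y
    using that by blast
  ultimately show ?thesis
    unfolding local_cohomology_graded_def by (smt (verit) mem_Collect_eq)
qed

text \<open>The semigroup \<open>S'\<close> with \<open>H\<^sup>1 = K[S'] / K[S]\<close>.\<close>

definition saturation :: "(int \<times> int) set" where
  "saturation = {x. \<forall>i\<le>k. \<exists>n. multiple n (exponent a k i) + x \<in> semigroup a k}"

text \<open>Adding multiples of \<open>e_0 = (0, d)\<close> keeps the first coordinate, adding
  multiples of \<open>e_k = (d, 0)\<close> keeps the second.\<close>

lemma saturation_bounds:
  assumes "x \<in> saturation"
  shows "0 \<le> fst x" "0 \<le> snd x" "int (a k) dvd fst x + snd x"
proof -
  obtain m n where m: "multiple m (exponent a k 0) + x \<in> semigroup a k"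
    and n: "multiple n (exponent a k k) + x \<in> semigroup a k"
    using assms unfolding saturation_def by blast
  show "0 \<le> fst x"
    using semigroup_bounds[OF m] a_0 by (simp add: multiple_def exponent_def)
  show "0 \<le> snd x"
    using semigroup_bounds[OF n] by (simp add: multiple_def exponent_def)
  have "int (a k) dvd int (a k) * int n + (fst x + snd x)"
    using semigroup_bounds[OF n] by (simp add: multiple_def exponent_def algebra_simps)
  then show "int (a k) dvd fst x + snd x"
    using dvd_add_right_iff[of "int (a k)" "int (a k) * int n"] by simp
qed

lemma saturation_add:
  assumes "x \<in> saturation" "y \<in> semigroup a k"
  shows "x + y \<in> saturation"
  unfolding saturation_def
proof (intro CollectI allI impI)
  fix i
  assume "i \<le> k"
  then obtain n where "multiple n (exponent a k i) + x \<in> semigroup a k"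
    using assms(1) unfolding saturation_def by blast
  then have "multiple n (exponent a k i) + x + y \<in> semigroup a k"
    using assms(2) by (rule semigroup_add)
  then show "\<exists>n. multiple n (exponent a k i) + (x + y) \<in> semigroup a k"
    by (auto simp only: add.assoc)
qed

lemma local_cocycles_1:
  "(local_cocycles a k 1 :: (nat set \<Rightarrow> 'k::field laurent) set)
    = constant_cochain k ` {g. Poly_Mapping.keys g \<subseteq> saturation}"
proof -
  have "g \<in> (\<Inter>i\<in>{0..k}. localization (semigroup_ring a k) (generator a k i))
      \<longleftrightarrow> Poly_Mapping.keys g \<subseteq> saturation" for g :: "'k laurent"
  proof -
    have "g \<in> (\<Inter>i\<in>{0..k}. localization (semigroup_ring a k) (generator a k i))
      \<longleftrightarrow> (\<forall>i\<le>k. \<forall>x\<in>Poly_Mapping.keys g. \<exists>n. multiple n (exponent a k i) + x \<in> semigroup a k)"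
      by (auto simp: generator_def localization_monomial_iff exponent_in_semigroup)
    then show ?thesis
      unfolding saturation_def by blast
  qed
  then have "(\<Inter>i\<in>{0..k}. localization (semigroup_ring a k) (generator a k i))
      = {g :: 'k laurent. Poly_Mapping.keys g \<subseteq> saturation}"
    by blast
  then show ?thesis
    by (simp only: cech_cocycles_1)
qed

text \<open>\<open>K[S']\<close> and \<open>K[S]\<close> are spanned by monomials, so a nonzero
  class has a monomial outside \<open>S\<close>, and conversely such a monomial alone represents a
  nonzero class.\<close>

lemma local_cohomology_1_nonzero_iff:
  "(local_cohomology_graded a k 1 n :: (nat set \<Rightarrow> 'k::field laurent) set set)
      \<noteq> {local_class a k 1 (\<lambda>_. 0)}
    \<longleftrightarrow> (\<exists>x \<in> saturation - semigroup a k. fst x + snd x = n * int (a k))"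
    (is "?L \<longleftrightarrow> ?R")
proof
  assume ?L
  then obtain z where z: "z \<in> local_cocycles a k 1" "\<forall>I. homogeneous (a k) n (z I)"
    "z \<notin> cech_coboundaries (semigroup_ring a k :: 'k laurent set) (generator a k) k 1"
    unfolding local_cohomology_nonzero_iff by blast
  then obtain g :: "'k laurent" where g: "z = constant_cochain k g" "Poly_Mapping.keys g \<subseteq> saturation"
    unfolding local_cocycles_1 by auto
  have "g \<notin> semigroup_ring a k"
    using z(3) unfolding cech_coboundaries_1 g(1) by blast
  then obtain x where x: "x \<in> Poly_Mapping.keys g" "x \<notin> semigroup a k"
    by (auto simp: semigroup_ring_def)
  have "homogeneous (a k) n g"
    using z(2)[rule_format, of "{0}"] g(1) by simp
  then have "fst x + snd x = n * int (a k)"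
    using x(1) by (auto simp: homogeneous_def)
  then show ?R
    using x g(2) by blast
next
  assume ?R
  then obtain x where x: "x \<in> saturation" "x \<notin> semigroup a k" "fst x + snd x = n * int (a k)"
    by blast
  define g :: "'k laurent" where "g = Poly_Mapping.single x 1"
  have keys: "Poly_Mapping.keys g = {x}"
    by (simp add: g_def)
  have "constant_cochain k g \<in> local_cocycles a k 1"
    using x(1) keys unfolding local_cocycles_1 by (intro imageI) simp
  moreover have "homogeneous (a k) n (constant_cochain k g I)" for I
    using x(3) keys by (auto simp: homogeneous_def constant_cochain_def)
  moreover have "constant_cochain k g \<notin> cech_coboundaries (semigroup_ring a k) (generator a k) k 1"
    using x(2) keys unfolding cech_coboundaries_1 by (auto simp: semigroup_ring_def)
  ultimately show ?L
    unfolding local_cohomology_nonzero_iff by blast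
qed

text \<open>The maximal ideal, \<open>K[S']\<close> and \<open>K[S]\<close> are all spanned by
  monomials, so it is enough to multiply monomials, that is, to add exponents.\<close>

lemma buchsbaum_iff:
  "buchsbaum TYPE('k::field) a k
    \<longleftrightarrow> (\<forall>x \<in> saturation. \<forall>y \<in> semigroup a k. y \<noteq> 0 \<longrightarrow> x + y \<in> semigroup a k)"
    (is "_ \<longleftrightarrow> ?R")
proof -
  let ?K = "semigroup_ring a k :: 'k laurent set"
  have zero_ring: "(0 :: 'k laurent) \<in> ?K"
    by (simp add: semigroup_ring_def)
  have scale: "(\<lambda>I. f * constant_cochain k g I) = constant_cochain k (f * g)" for f g :: "'k laurent"
    by (auto simp: constant_cochain_def fun_eq_iff)
  have keys: "\<exists>x\<in>Poly_Mapping.keys g. \<exists>y\<in>semigroup a k. y \<noteq> 0 \<and> w = x + y"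
    if f: "f \<in> max_homogeneous_ideal a k" and w: "w \<in> Poly_Mapping.keys (f * g)"
    for f g :: "'k laurent" and w
  proof -
    obtain y x where yx: "y \<in> Poly_Mapping.keys f" "x \<in> Poly_Mapping.keys g" "w = y + x"
      using w keys_mult[of f g] by blast
    have "y \<in> semigroup a k"
      using f yx(1) unfolding max_homogeneous_ideal_def semigroup_ring_def by blast
    moreover have "y \<noteq> 0"
      using f yx(1) unfolding max_homogeneous_ideal_def in_keys_iff by blast
    moreover have "w = x + y"
      unfolding yx(3) by (rule add.commute)
    ultimately show ?thesis
      using yx(2) by blast
  qed
  have cls: "local_class a k 1 (\<lambda>I. f * constant_cochain k g I) = local_class a k 1 (\<lambda>_. 0)
      \<longleftrightarrow> f * g \<in> ?K"
    if f: "f \<in> max_homogeneous_ideal a k" and g: "Poly_Mapping.keys g \<subseteq> saturation" for f g :: "'k laurent"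
  proof -
    have "Poly_Mapping.keys (f * g) \<subseteq> saturation"
      using keys[OF f] g saturation_add by blast
    then have "constant_cochain k (f * g) \<in> local_cocycles a k 1"
      unfolding local_cocycles_1 by blast
    then have "local_class a k 1 (constant_cochain k (f * g)) = local_class a k 1 (\<lambda>_. 0)
      \<longleftrightarrow> constant_cochain k (f * g) \<in> cech_coboundaries ?K (generator a k) k 1"
      by (intro cohomology_class_eq_zero_iff cech_coboundaries_diff zero_in_cech_coboundaries zero_ring
          semigroup_ring_diff semigroup_ring_mult one_in_semigroup_ring generator_in_semigroup_ring)
    also have "\<dots> \<longleftrightarrow> f * g \<in> ?K"
      unfolding cech_coboundaries_1 by (rule inj_image_mem_iff) (simp add: inj_def)
    finally show ?thesis
      by (simp only: scale)
  qed
  have "buchsbaum TYPE('k) a k \<longleftrightarrow>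
    (\<forall>f\<in>max_homogeneous_ideal a k. \<forall>g::'k laurent. Poly_Mapping.keys g \<subseteq> saturation \<longrightarrow> f * g \<in> ?K)"
    unfolding buchsbaum_def local_cocycles_1 using cls by simp
  also have "\<dots> \<longleftrightarrow> ?R"
  proof (intro iffI ballI impI allI)
    fix x y
    assume H: "\<forall>f\<in>max_homogeneous_ideal a k. \<forall>g::'k laurent. Poly_Mapping.keys g \<subseteq> saturation \<longrightarrow> f * g \<in> ?K"
      and x: "x \<in> saturation" and y: "y \<in> semigroup a k" "y \<noteq> 0"
    have "Poly_Mapping.single y (1::'k) \<in> max_homogeneous_ideal a k"
      using y by (simp add: max_homogeneous_ideal_def semigroup_ring_def lookup_single)
    then have "Poly_Mapping.single y 1 * Poly_Mapping.single x 1 \<in> ?K"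
      using H x by simp
    then show "x + y \<in> semigroup a k"
      by (simp add: mult_single semigroup_ring_def add.commute)
  next
    fix f g :: "'k laurent"
    assume "?R" "f \<in> max_homogeneous_ideal a k" "Poly_Mapping.keys g \<subseteq> saturation"
    then show "f * g \<in> ?K"
      using keys[of f _ g] unfolding semigroup_ring_def by blast
  qed
  finally show ?thesis .
qed


section \<open>Regularity\<close>

definition saturated_from_degree_2 :: bool where
  "saturated_from_degree_2 \<longleftrightarrow>
    (\<forall>x\<in>saturation. 2 * int (a k) \<le> fst x + snd x \<longrightarrow> x \<in> semigroup a k)"

text \<open>A nonzero element of \<open>S'\<close> and a nonzero element of \<open>S\<close> each
  have degree at least 1, so their sum has degree at least 2.\<close>

lemma buchsbaum_if_saturated_from_degree_2:
  assumes "saturated_from_degree_2"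
  shows "buchsbaum TYPE('k::field) a k"
  unfolding buchsbaum_iff
proof (intro ballI impI)
  fix x y
  assume x: "x \<in> saturation" and y: "y \<in> semigroup a k" "y \<noteq> 0"
  show "x + y \<in> semigroup a k"
  proof (cases "x = 0")
    case False
    then have "0 < fst x + snd x"
      using saturation_bounds[OF x] by (auto simp: prod_eq_iff)
    then have "int (a k) \<le> fst x + snd x"
      using saturation_bounds[OF x] by (simp add: zdvd_imp_le)
    then have "2 * int (a k) \<le> fst (x + y) + snd (x + y)"
      using semigroup_degree_pos[OF y] by simp
    then show ?thesis
      using assms saturation_add[OF x y(1)] unfolding saturated_from_degree_2_def by blast
  qed (use y in simp)
qed

lemma a_invariant_le_iff:
  "a_invariant TYPE('k::field) a k p \<le> ereal (real_of_int m) \<longleftrightarrow>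
    (\<forall>n. (local_cohomology_graded a k p n :: (nat set \<Rightarrow> 'k laurent) set set)
      \<noteq> {local_class a k p (\<lambda>_. 0)} \<longrightarrow> n \<le> m)"
  unfolding a_invariant_def SUP_le_iff by simp

text \<open>Degrees in \<open>S'\<close> are integers, so a degree exceeding 1 means
  \<open>u + v\<close> is at least \<open>2 d\<close>.\<close>

lemma a_invariant_1_le_1_iff:
  "a_invariant TYPE('k::field) a k 1 \<le> 1 \<longleftrightarrow> saturated_from_degree_2"
proof -
  have "a_invariant TYPE('k) a k 1 \<le> 1 \<longleftrightarrow>
      (\<forall>n. (\<exists>x \<in> saturation - semigroup a k. fst x + snd x = n * int (a k)) \<longrightarrow> n \<le> 1)"
    using a_invariant_le_iff[where 'k = 'k and m = 1 and p = 1]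
    unfolding local_cohomology_1_nonzero_iff by (simp add: one_ereal_def)
  also have "\<dots> \<longleftrightarrow> saturated_from_degree_2"
  proof
    assume H: "\<forall>n. (\<exists>x \<in> saturation - semigroup a k. fst x + snd x = n * int (a k)) \<longrightarrow> n \<le> 1"
    show saturated_from_degree_2
      unfolding saturated_from_degree_2_def
    proof (intro ballI impI)
      fix x
      assume x: "x \<in> saturation" "2 * int (a k) \<le> fst x + snd x"
      obtain n where n: "fst x + snd x = n * int (a k)"
        using saturation_bounds(3)[OF x(1)] by (auto simp: dvd_def mult.commute)
      then have "2 \<le> n"
        using x(2) degree_pos by simp
      then show "x \<in> semigroup a k"
        using H x(1) n by fastforce
    qed
  next
    assume H: saturated_from_degree_2
    show "\<forall>n. (\<exists>x \<in> saturation - semigroup a k. fst x + snd x = n * int (a k)) \<longrightarrow> n \<le> 1"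
    proof (intro allI impI, rule ccontr)
      fix n :: int
      assume "\<exists>x \<in> saturation - semigroup a k. fst x + snd x = n * int (a k)" and n: "\<not> n \<le> 1"
      then obtain x where x: "x \<in> saturation" "x \<notin> semigroup a k" "fst x + snd x = n * int (a k)"
        by blast
      have "2 * int (a k) \<le> fst x + snd x"
        unfolding x(3) using n by (intro mult_right_mono) auto
      then show False
        using H x unfolding saturated_from_degree_2_def by blast
    qed
  qed
  finally show ?thesis .
qed

lemma saturated_from_degree_2_if_regularity:
  assumes "regularity TYPE('k::field) a k = 2"
  shows "saturated_from_degree_2"
proof -
  have "a_invariant TYPE('k) a k 1 + 1 \<le> 2"
    using assms unfolding regularity_def by (metis max.cobounded1)
  then have "a_invariant TYPE('k) a k 1 \<le> 1"
    by (cases "a_invariant TYPE('k) a k 1") (auto simp: one_ereal_def)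
  then show ?thesis
    by (simp only: a_invariant_1_le_1_iff)
qed

section \<open>Sequences with small gaps\<close>

lemma gap_exists:
  assumes "w \<le> a k" "w \<notin> a ` {0..k}"
  shows "\<exists>i\<in>{1..k}. a (i - 1) < w \<and> w < a i"
proof -
  \<comment> \<open>The first member of the sequence not below \<open>w\<close> is the right end of
    the gap.\<close>
  define i where "i = (LEAST i. w \<le> a i)"
  have i: "w \<le> a i" "i \<le> k"
    unfolding i_def using assms(1) by (auto intro: LeastI Least_le)
  have "i \<noteq> 0"
    using i(1) assms(2) a_0 by (metis atLeastAtMost_iff image_eqI le_zero_eq zero_le)
  moreover from this have "\<not> w \<le> a (i - 1)"
    unfolding i_def by (intro not_less_Least) (simp add: i_def[symmetric])
  moreover have "w \<noteq> a i"
    using assms(2) i(2) by auto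
  ultimately show ?thesis
    using i by (intro bexI[of _ i]) auto
qed

text \<open>The set in the definition of \<open>epsilon\<close> contains 0 and is bounded by
  \<open>d\<close>, so its maximum is attained.\<close>

lemma epsilon_mem:
  assumes "1 \<le> j" "j \<le> epsilon a k"
  shows "j \<in> a ` {1..k - 1} \<and> a k - j \<in> a ` {1..k - 1}"
proof -
  let ?E = "{i. \<forall>j \<in> {1..i}. j \<in> a ` {1..k - 1} \<and> a k - j \<in> a ` {1..k - 1}}"
  have "i \<le> a k" if "i \<in> ?E" for i
  proof (cases "i = 0")
    case False
    then have "i \<in> a ` {1..k - 1}"
      using that by auto
    then show ?thesis
      using a_le by auto
  qed simp
  then have "finite ?E"
    by (meson finite_nat_set_iff_bounded_le)
  moreover have "0 \<in> ?E"
    by simp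
  ultimately have "epsilon a k \<in> ?E"
    unfolding epsilon_def by (intro Max_in) blast+
  then show ?thesis
    using assms by simp
qed

lemma gap_le_lambda_max:
  assumes "i \<in> {1..k}"
  shows "a i - a (i - 1) - 1 \<le> lambda_max a k"
  unfolding lambda_max_def using assms by (intro Max_ge) auto

lemma exponent_add_mem:
  assumes "i \<le> k" "j \<le> k" "w = a i + a j"
  shows "(int w, int (2 * a k) - int w) \<in> semigroup a k"
  using semigroup_add[OF exponent_in_semigroup[OF assms(1)] exponent_in_semigroup[OF assms(2)]] assms(3)
  by (simp add: exponent_def algebra_simps)

text \<open>In a gap \<open>a (i - 1) < w < a i\<close> the distance of \<open>w\<close> to either end is at most \<open>\<epsilon>\<close>, so \<open>w\<close> is
  \<open>a (i - 1)\<close> plus one of \<open>1, \<dots>, \<epsilon>\<close>, and \<open>d + w\<close> is \<open>a i\<close> plus one of \<open>d - 1, \<dots>, d - \<epsilon>\<close>.\<close>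

lemma degree_2_mem:
  assumes gap: "lambda_max a k \<le> epsilon a k" and w: "w \<le> 2 * a k"
  shows "(int w, int (2 * a k) - int w) \<in> semigroup a k"
proof (cases "w \<le> a k")
  case True
  show ?thesis
  proof (cases "w \<in> a ` {0..k}")
    case True
    then obtain i where "i \<le> k" "w = a i"
      by auto
    then show ?thesis
      using exponent_add_mem[of i 0] a_0 by simp
  next
    case False
    then obtain i where i: "i \<in> {1..k}" "a (i - 1) < w" "w < a i"
      using gap_exists \<open>w \<le> a k\<close> by blast
    then have "w - a (i - 1) \<in> a ` {1..k - 1}"
      using gap_le_lambda_max[OF i(1)] gap by (intro epsilon_mem[THEN conjunct1]) auto
    then obtain j where "j \<in> {1..k - 1}" "w - a (i - 1) = a j"
      by blast
    then show ?thesis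
      using i by (intro exponent_add_mem[of "i - 1" j]) auto
  qed
next
  case False
  define w' where "w' = w - a k"
  have w': "w = a k + w'" "w' \<le> a k"
    using False w by (auto simp: w'_def)
  show ?thesis
  proof (cases "w' \<in> a ` {0..k}")
    case True
    then obtain i where "i \<le> k" "w' = a i"
      by auto
    then show ?thesis
      using w'(1) by (intro exponent_add_mem[of k i]) auto
  next
    case False
    then obtain i where i: "i \<in> {1..k}" "a (i - 1) < w'" "w' < a i"
      using gap_exists w'(2) by blast
    then have "a k - (a i - w') \<in> a ` {1..k - 1}"
      using gap_le_lambda_max[OF i(1)] gap by (intro epsilon_mem[THEN conjunct2]) auto
    then obtain j where "j \<in> {1..k - 1}" "a k - (a i - w') = a j"
      by blast
    then show ?thesis
      using i w'(1) a_le[of i] by (intro exponent_add_mem[of i j]) auto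
  qed
qed

text \<open>Every point of the quadrant of integral degree at least 2 lies in \<open>S\<close>:
  \<open>degree_2_mem\<close> starts an induction on the degree whose step removes
  \<open>e_k\<close> or \<open>e_0\<close>.\<close>

lemma saturated_from_degree_2_if_small_gaps:
  assumes gap: "lambda_max a k \<le> epsilon a k"
  shows "saturated_from_degree_2"
proof -
  have mem: "(int w, int (n * a k) - int w) \<in> semigroup a k" if "2 \<le> n" "w \<le> n * a k" for n w
    using that
  proof (induction n arbitrary: w rule: dec_induct)
    case base
    then show ?case
      using degree_2_mem[OF gap] by simp
  next
    case (step n)
    show ?case
    proof (cases "a k \<le> w")
      case True
      then have "(int (w - a k), int (n * a k) - int (w - a k)) + exponent a k k \<in> semigroup a k"
        using step.prems by (intro semigroup_add exponent_in_semigroup step.IH) auto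
      then show ?thesis
        using True by (simp add: exponent_def algebra_simps)
    next
      case False
      \<comment> \<open>Since \<open>w < d\<close>, this bound keeps the point in the quadrant after
        \<open>e_0\<close> is removed.\<close>
      moreover have "a k \<le> n * a k"
        using step.hyps by simp
      ultimately have "w \<le> n * a k"
        by linarith
      then have "(int w, int (n * a k) - int w) + exponent a k 0 \<in> semigroup a k"
        by (intro semigroup_add exponent_in_semigroup step.IH) auto
      then show ?thesis
        using a_0 by (simp add: exponent_def algebra_simps)
    qed
  qed
  show ?thesis
    unfolding saturated_from_degree_2_def
  proof (intro ballI impI)
    fix x
    assume x: "x \<in> saturation" "2 * int (a k) \<le> fst x + snd x"
    obtain n where n: "fst x + snd x = n * int (a k)"
      using saturation_bounds(3)[OF x(1)] by (auto simp: dvd_def mult.commute)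
    have n2: "2 \<le> n"
      using x(2) n degree_pos by simp
    have fx: "int (nat (fst x)) = fst x" "int (nat n) = n"
      using saturation_bounds(1)[OF x(1)] n2 by auto
    have "int (nat (fst x)) \<le> int (nat n * a k)"
      using saturation_bounds(2)[OF x(1)] n fx by simp
    then have "(int (nat (fst x)), int (nat n * a k) - int (nat (fst x))) \<in> semigroup a k"
      using n2 by (intro mem) linarith+
    moreover have "int (nat n * a k) - int (nat (fst x)) = snd x"
      using n fx by simp
    ultimately show "x \<in> semigroup a k"
      using fx by simp
  qed
qed

end


section \<open>Curves whose two coordinate points are smooth\<close>

locale smooth_ends = projective_monomial_curve +
  assumes a_1: "a 1 = 1" and a_last: "a (k - 1) = a k - 1"
begin

text \<open>A point \<open>x = (p, q)\<close> of degree \<open>n\<close> equals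
  \<open>n e_0 + p (e_1 - e_0)\<close> and also \<open>n e_k + q (e_(k-1) - e_k)\<close>. It remains
  to absorb the negative terms into a multiple of \<open>e_i\<close>.\<close>

lemma saturation_eq:
  "saturation = {x. 0 \<le> fst x \<and> 0 \<le> snd x \<and> int (a k) dvd fst x + snd x}"
proof (intro set_eqI iffI CollectI)
  fix x
  assume x: "x \<in> {x. 0 \<le> fst x \<and> 0 \<le> snd x \<and> int (a k) dvd fst x + snd x}"
  define p q n where "p = nat (fst x)" and "q = nat (snd x)" and "n = nat ((fst x + snd x) div int (a k))"
  have pq: "x = (int p, int q)"
    using x by (auto simp: p_def q_def prod_eq_iff)
  have "int n * int (a k) = fst x + snd x"
    using x by (auto simp: n_def pos_imp_zdiv_nonneg_iff degree_pos)
  then have n: "int n * int (a k) = int p + int q"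
    by (simp add: pq)
  show "x \<in> saturation"
    unfolding saturation_def
  proof (intro CollectI allI impI)
    fix i
    assume i: "i \<le> k"
    show "\<exists>n. multiple n (exponent a k i) + x \<in> semigroup a k"
    proof (cases "i = k")
      case True
      \<comment> \<open>Adding \<open>q e_k\<close> cancels the negative term of the second
        expression.\<close>
      have "multiple q (exponent a k (k - 1)) + multiple n (exponent a k k) \<in> semigroup a k"
        by (intro semigroup_add multiple_in_semigroup exponent_in_semigroup) auto
      also have "multiple q (exponent a k (k - 1)) + multiple n (exponent a k k) = multiple q (exponent a k k) + x"
        using degree_pos n by (simp add: a_last[simplified] multiple_def exponent_def pq algebra_simps)
      finally show ?thesis
        using True by blast
    next
      case False
      \<comment> \<open>Here \<open>d e_i = (d - a_i) e_0 + a_i e_k\<close> contains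
        \<open>e_0\<close> at least once. In each of \<open>p\<close> copies one \<open>e_0\<close>
        is traded for \<open>e_1\<close>, and \<open>r\<close> copies of \<open>e_0\<close> are
        left.\<close>
      define r where "r = a k - a i - 1"
      have r: "int r = int (a k) - int (a i) - 1"
        using a_less[of i k] False i by (simp add: r_def)
      have "multiple (p * r) (exponent a k 0) + multiple (p * a i) (exponent a k k)
          + (multiple p (exponent a k 1) + multiple n (exponent a k 0)) \<in> semigroup a k"
        using k_pos by (intro semigroup_add multiple_in_semigroup exponent_in_semigroup) auto
      also have "multiple (p * r) (exponent a k 0) + multiple (p * a i) (exponent a k k)
          + (multiple p (exponent a k 1) + multiple n (exponent a k 0))
          = multiple (a k * p) (exponent a k i) + x"
        using n by (simp add: a_0 a_1[simplified] multiple_def exponent_def pq r algebra_simps)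
      finally show ?thesis
        by blast
    qed
  qed
qed (use saturation_bounds in auto)

lemma saturated_from_degree_2_if_buchsbaum:
  assumes "buchsbaum TYPE('k::field) a k"
  shows "saturated_from_degree_2"
  unfolding saturated_from_degree_2_def
proof (intro ballI impI)
  have step: "x \<in> semigroup a k" if "x - exponent a k i \<in> saturation" "i \<le> k" for x i
  proof -
    have "exponent a k i \<noteq> 0"
      using degree_pos by (auto simp: exponent_def zero_prod_def)
    then have "(x - exponent a k i) + exponent a k i \<in> semigroup a k"
      using assms that exponent_in_semigroup[OF that(2)] unfolding buchsbaum_iff by blast
    then show ?thesis
      by simp
  qed
  fix x
  assume x: "x \<in> saturation" "2 * int (a k) \<le> fst x + snd x"
  have dvd: "int (a k) dvd fst x + snd x - int (a k)"
    using saturation_bounds(3)[OF x(1)] by simp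
  show "x \<in> semigroup a k"
  proof (cases "int (a k) \<le> fst x")
    case True
    then have "x - exponent a k k \<in> saturation"
      using saturation_bounds[OF x(1)] dvd by (simp add: saturation_eq exponent_def algebra_simps)
    then show ?thesis
      by (rule step) simp
  next
    case False
    \<comment> \<open>From \<open>u < d\<close> and \<open>u + v >= 2 d\<close> follows
      \<open>v >= d\<close>.\<close>
    then have "x - exponent a k 0 \<in> saturation"
      using saturation_bounds[OF x(1)] dvd x(2) a_0 by (simp add: saturation_eq exponent_def algebra_simps)
    then show ?thesis
      by (rule step) simp
  qed
qed

text \<open>By counting, the \<open>k + 1\<close> values \<open>a i\<close> miss some
  \<open>w\<close> among the \<open>d + 1\<close> numbers up to \<open>d\<close>; the point
  \<open>(w, d - w)\<close> is then in \<open>S'\<close> but not in \<open>S\<close>.\<close>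

lemma a_invariant_1_ge_1:
  assumes "k < a k"
  shows "1 \<le> a_invariant TYPE('k::field) a k 1"
proof -
  have "\<not> {0..a k} \<subseteq> a ` {0..k}"
  proof
    assume "{0..a k} \<subseteq> a ` {0..k}"
    then have "card {0..a k} \<le> card (a ` {0..k})"
      by (intro card_mono) auto
    also have "\<dots> \<le> card {0..k}"
      by (intro card_image_le) auto
    finally show False
      using assms by simp
  qed
  then obtain w where w: "w \<le> a k" "w \<notin> a ` {0..k}"
    by (meson atLeastAtMost_iff subsetI)
  let ?x = "(int w, int (a k) - int w)"
  have "?x \<in> saturation"
    using w(1) by (simp add: saturation_eq)
  moreover have "?x \<notin> semigroup a k"
    using semigroup_degree_1[of ?x] w(2) by auto
  ultimately have "\<exists>x \<in> saturation - semigroup a k. fst x + snd x = 1 * int (a k)"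
    by (intro bexI[of _ ?x]) auto
  then have "(local_cohomology_graded a k 1 1 :: (nat set \<Rightarrow> 'k laurent) set set)
      \<noteq> {local_class a k 1 (\<lambda>_. 0)}"
    by (simp only: local_cohomology_1_nonzero_iff)
  then have "ereal (real_of_int 1) \<le> a_invariant TYPE('k) a k 1"
    unfolding a_invariant_def by (intro SUP_upper) simp
  then show ?thesis
    by (simp add: one_ereal_def)
qed

text \<open>Describes the exponents available after inverting the generator \<open>i\<close>: a
  coordinate of \<open>x\<close> may be negative only where \<open>e_i\<close> is positive, for then
  a large multiple moves it into the quadrant.\<close>

lemma large_multiple_in_semigroup:
  assumes sat: "saturated_from_degree_2"
    and "int (a k) dvd fst x + snd x"
    and fst: "0 < a i \<or> 0 \<le> fst x" and snd: "a i < a k \<or> 0 \<le> snd x"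
    and i: "i \<le> k"
  shows "\<exists>n. multiple n (exponent a k i) + x \<in> semigroup a k"
proof -
  \<comment> \<open>The absolute values outweigh negative coordinates, and the extra 2 lifts the
    degree to at least 2.\<close>
  define n where "n = nat \<bar>fst x\<bar> + nat \<bar>snd x\<bar> + 2"
  let ?y = "multiple n (exponent a k i) + x"
  have n: "int n = \<bar>fst x\<bar> + \<bar>snd x\<bar> + 2"
    by (simp add: n_def)
  have grow: "int n * 1 \<le> int n * m" if "0 < m" for m
    using that by (intro mult_left_mono) auto
  have y: "fst ?y = int n * int (a i) + fst x" "snd ?y = int n * (int (a k) - int (a i)) + snd x"
    by (auto simp: multiple_def exponent_def)
  have sum: "fst ?y + snd ?y = int n * int (a k) + (fst x + snd x)"
    by (simp only: y) (simp add: algebra_simps)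
  have "0 \<le> fst ?y"
    using fst grow[of "int (a i)"] n unfolding y by fastforce
  moreover have "0 \<le> snd ?y"
    using snd grow[of "int (a k) - int (a i)"] n a_le[OF i] unfolding y by fastforce
  moreover have "int (a k) dvd fst ?y + snd ?y"
    unfolding sum using assms(2) by simp
  moreover have "2 * int (a k) \<le> fst ?y + snd ?y"
  proof -
    have "(\<bar>fst x\<bar> + \<bar>snd x\<bar>) * 1 \<le> (\<bar>fst x\<bar> + \<bar>snd x\<bar>) * int (a k)"
      using degree_pos by (intro mult_left_mono) auto
    then show ?thesis
      unfolding sum n by (simp add: algebra_simps)
  qed
  ultimately show ?thesis
    using sat unfolding saturated_from_degree_2_def saturation_eq by blast
qed

text \<open>The primitive is read off the components \<open>z {0, i}\<close>; the only choice is to split \<open>z {0, k}\<close> into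
  the monomials with \<open>u \<ge> 0\<close>, which lie in \<open>K[S]\<close> localized at the generator \<open>0\<close>, and the others,
  where \<open>v \<ge> 0\<close> because the degree is nonnegative.\<close>

lemma cocycle_2_is_coboundary:
  fixes z :: "nat set \<Rightarrow> 'k::field laurent"
  assumes sat: "saturated_from_degree_2"
    and z: "z \<in> local_cocycles a k 2"
    and nonneg: "\<And>I x. x \<in> Poly_Mapping.keys (z I) \<Longrightarrow> 0 \<le> fst x + snd x"
  shows "z \<in> cech_coboundaries (semigroup_ring a k) (generator a k) k 2"
proof -
  have zC: "z \<in> cech_cochains (semigroup_ring a k) (generator a k) k 2"
    and dz: "cech_differential k z J = 0" for J
    using z by (auto simp: cech_cocycles_def)
  define P where "P = Poly_Mapping.mapp (\<lambda>x c. c when 0 \<le> fst x) (z {0, k})"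
  have P: "Poly_Mapping.lookup P x = (Poly_Mapping.lookup (z {0, k}) x when 0 \<le> fst x)" for x
    by (auto simp: P_def lookup_mapp when_def in_keys_iff)
  \<comment> \<open>Subtracting the same \<open>P\<close> at every vertex does not affect
    differences; it leaves \<open>- P\<close> at vertex 0 and the part of \<open>z {0, k}\<close>
    with \<open>u < 0\<close> at vertex \<open>k\<close>.\<close>
  define \<beta> where "\<beta> i = (if i = 0 then 0 else z {0, i}) - P" for i
  define b where "b I = (if \<exists>i\<le>k. I = {i} then \<beta> (the_elem I) else 0)" for I
  have b: "b {i} = \<beta> i" if "i \<le> k" for i
    using that by (auto simp: b_def)
  have \<beta>: "\<beta> i \<in> localization (semigroup_ring a k) (generator a k i)" if i: "i \<le> k" for i
    unfolding generator_def localization_monomial_iff[OF exponent_in_semigroup[OF i]]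
  proof
    fix x
    assume x: "x \<in> Poly_Mapping.keys (\<beta> i)"
    then have "x \<in> Poly_Mapping.keys (z {0, i}) \<or> x \<in> Poly_Mapping.keys (z {0, k})"
      by (auto simp: \<beta>_def in_keys_iff lookup_minus P split: if_splits)
    then have dvd: "int (a k) dvd fst x + snd x"
      using local_cochain_keys[OF zC] by blast
    have "0 < a i \<or> 0 \<le> fst x"
    proof (cases "i = 0")
      case True
      then show ?thesis
        using x by (auto simp: \<beta>_def in_keys_iff lookup_minus P)
    qed (use a_less[of 0 i] i in auto)
    moreover have "a i < a k \<or> 0 \<le> snd x"
    proof (cases "i = k")
      case True
      then have "x \<in> Poly_Mapping.keys (z {0, k})" "\<not> 0 \<le> fst x"
        using x k_pos by (auto simp: \<beta>_def in_keys_iff lookup_minus P when_def split: if_splits)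
      then show ?thesis
        using nonneg by fastforce
    qed (use a_less[of i k] i in auto)
    ultimately show "\<exists>n. multiple n (exponent a k i) + x \<in> semigroup a k"
      by (intro large_multiple_in_semigroup[OF sat dvd _ _ i])
  qed
  have "b \<in> cech_cochains (semigroup_ring a k) (generator a k) k 1"
    unfolding cech_cochains_def mem_Collect_eq subset_card_1_iff
  proof
    fix I
    show "if \<exists>i\<le>k. I = {i} then b I \<in> localization (semigroup_ring a k) (\<Prod>i\<in>I. generator a k i) else b I = 0"
      using \<beta> by (auto simp: b_def)
  qed
  moreover have "cech_differential k b J = z J" for J
  proof (cases "J \<subseteq> {0..k} \<and> card J = 2")
    case True
    then have "card J = 2"
      by simp
    then obtain i j where ij: "i < j" "J = {i, j}"
      by (rule card_2_ordered)
    then have j: "j \<le> k"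
      using True by simp
    \<comment> \<open>\<open>P\<close> cancels; for \<open>i > 0\<close> the rest is the cocycle
      equation on \<open>{0, i, j}\<close>.\<close>
    have "\<beta> j - \<beta> i = z {i, j}"
    proof (cases "i = 0")
      case False
      then show ?thesis
        using dz[of "{0, i, j}"] cech_differential_triple[of 0 i j k z] ij j
        by (simp add: \<beta>_def algebra_simps)
    qed (use ij in \<open>simp add: \<beta>_def\<close>)
    then show ?thesis
      using ij j by (simp add: cech_differential_pair b)
  next
    case False
    have "z J = 0"
      using spec[OF zC[unfolded cech_cochains_def mem_Collect_eq], of J] by (simp only: False if_False)
    moreover have "cech_differential k b J = 0"
    proof (cases "J \<subseteq> {0..k}")
      case True
      have "b I = 0" if "card I \<noteq> 1" for I
        using that by (auto simp: b_def)
      then show ?thesis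
        using True False by (intro cech_differential_eq_zero[where p = 1]) auto
    qed (simp add: cech_differential_def)
    ultimately show ?thesis
      by simp
  qed
  ultimately show ?thesis
    unfolding numeral_2_eq_2 cech_coboundaries.simps One_nat_def by (metis ext image_eqI)
qed

lemma a_invariant_2_le_0:
  assumes sat: "saturated_from_degree_2"
  shows "a_invariant TYPE('k::field) a k 2 \<le> 0"
proof -
  have "n \<le> 0" if nonzero: "(local_cohomology_graded a k 2 n :: (nat set \<Rightarrow> 'k laurent) set set)
      \<noteq> {local_class a k 2 (\<lambda>_. 0)}" for n
  proof (rule ccontr)
    assume n: "\<not> n \<le> 0"
    obtain z :: "nat set \<Rightarrow> 'k laurent" where z: "z \<in> local_cocycles a k 2"
      "\<And>I. homogeneous (a k) n (z I)"
      "z \<notin> cech_coboundaries (semigroup_ring a k) (generator a k) k 2"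
      using nonzero unfolding local_cohomology_nonzero_iff by blast
    have "0 \<le> fst x + snd x" if "x \<in> Poly_Mapping.keys (z I)" for x I
    proof -
      have "fst x + snd x = n * int (a k)"
        using z(2)[of I] that by (auto simp: homogeneous_def)
      then show ?thesis
        using n by simp
    qed
    then show False
      using cocycle_2_is_coboundary[OF sat z(1)] z(3) by blast
  qed
  then show ?thesis
    using a_invariant_le_iff[where 'k = 'k and m = 0 and p = 2] by (simp add: zero_ereal_def)
qed

text \<open>The first term of the maximum is exactly 2, by the upper and lower bounds for
  \<open>H^1\<close>, and the second is at most 2.\<close>

lemma regularity_eq_2:
  assumes "saturated_from_degree_2" "k < a k"
  shows "regularity TYPE('k::field) a k = 2"
proof -
  have "a_invariant TYPE('k) a k 1 = 1"
    using assms a_invariant_1_ge_1 a_invariant_1_le_1_iff by (intro antisym) blast+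
  then have "a_invariant TYPE('k) a k 1 + 1 = 2"
    by simp
  moreover have "a_invariant TYPE('k) a k 2 + 2 \<le> 0 + 2"
    using a_invariant_2_le_0[OF assms(1)] by (rule add_right_mono)
  ultimately show ?thesis
    unfolding regularity_def by (simp add: max_def)
qed

end

theorem corollary4p9:
  fixes a :: "nat \<Rightarrow> nat" and k d :: nat
  assumes "k \<ge> 3"
    and "a 0 = 0"
    and "strict_mono_on {0..k} a"
    and "a k = d"
    and "Gcd (a ` {1..k}) = 1"
    and "k < d"
  shows "(regularity TYPE('k::field) a k = 2 \<longrightarrow> buchsbaum TYPE('k) a k)
    \<and> (a 1 = 1 \<and> a (k - 1) = d - 1 \<longrightarrow>
         (buchsbaum TYPE('k) a k \<longleftrightarrow> regularity TYPE('k) a k = 2))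
    \<and> (a 1 = 1 \<and> a (k - 1) = d - 1 \<and> lambda_max a k \<le> epsilon a k \<longrightarrow>
         buchsbaum TYPE('k) a k)"
proof -
  interpret projective_monomial_curve a k
    using assms by unfold_locales auto
  have i: "regularity TYPE('k) a k = 2 \<Longrightarrow> buchsbaum TYPE('k) a k"
    by (intro buchsbaum_if_saturated_from_degree_2 saturated_from_degree_2_if_regularity)
  \<comment> \<open>The other direction of the equivalence is \<open>i\<close>.\<close>
  have ii: "regularity TYPE('k) a k = 2"
    if "a 1 = 1" "a (k - 1) = d - 1" and B: "buchsbaum TYPE('k) a k"
  proof -
    interpret smooth_ends a k
      using that assms(4) by unfold_locales auto
    show ?thesis
      using assms by (intro regularity_eq_2 saturated_from_degree_2_if_buchsbaum[OF B]) simp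
  qed
  have iii: "lambda_max a k \<le> epsilon a k \<Longrightarrow> buchsbaum TYPE('k) a k"
    by (intro buchsbaum_if_saturated_from_degree_2 saturated_from_degree_2_if_small_gaps)
  show ?thesis
    using i ii iii by blast
qed

end
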